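(* Let $A = (a_{pq})_{p,q=1}^2$ be a real $2 \times 2$ matrix. The following are equivalent. (1) For all integers $m, n \geq 2$ and all $\{i_1 < i_2\} \subseteq \{1,\dots,m\}$ and $\{j_1 < j_2\} \subseteq \{1,\dots,n\}$, there exists an $m \times n$ matrix $\widetilde{A}$, which is a positive multiple of a generalized Vandermonde matrix, such that $\widetilde{A}_{i_p,j_q} = a_{pq}$ for $p, q = 1, 2$. (2) For all totally ordered sets $X$ and $Y$ such that $X \times Y$ admits a totally positive kernel, and all pairs $\{x_1 < x_2\} \subseteq X$ and $\{y_1 < y_2\} \subseteq Y$, there exists a totally positive kernel $K$ on $X \times Y$ such that $K(x_p,y_q) = a_{pq}$ for $p, q = 1, 2$. (3) The matrix $A$ is totally positive.
   Context: A generalized Vandermonde $m \times n$ matrix is a matrix of the form $(u_i^{\alpha_j})_{1 \leq i \leq m,\, 1 \leq j \leq n}$ where the $u_i$ are positive reals, the $\alpha_j$ are reals, and either $u_1 < \cdots < u_m$ and $\alpha_1 < \cdots < \alpha_n$, or $u_1 > \cdots > u_m$ and $\alpha_1 > \cdots > \alpha_n$. A real matrix is totally positive if all of its minors are positive. For totally ordered sets $X, Y$, a kernel $K : X \times Y \to \mathbb{R}$ is totally positive if $\det(K(x_i,y_j))_{i,j=1}^n > 0$ for all $n \in \mathbb{N}$ and all $x_1 < \cdots < x_n$ in $X$, $y_1 < \cdots < y_n$ in $Y$. *)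

theory Defs
  imports
    Complex_Main
    "Jordan_Normal_Form.Determinant"
    "Jordan_Normal_Form.DL_Submatrix"
begin

(* Matrices are those of Jordan_Normal_Form, whose sizes are natural numbers; rows and
   columns are therefore indexed from 0. *)

definition gen_vandermonde :: "real mat \<Rightarrow> bool" where
  "gen_vandermonde V \<longleftrightarrow>
     (\<exists>u \<alpha> :: nat \<Rightarrow> real.
        (\<forall>i < dim_row V. 0 < u i) \<and>
        (strict_mono_on {..<dim_row V} u \<and> strict_mono_on {..<dim_col V} \<alpha> \<or>
         strict_antimono_on {..<dim_row V} u \<and> strict_antimono_on {..<dim_col V} \<alpha>) \<and>
        V = mat (dim_row V) (dim_col V) (\<lambda>(i, j). u i powr \<alpha> j))"

(* The empty minor is harmless: the determinant of the 0 x 0 matrix is 1. *)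
definition totally_positive :: "real mat \<Rightarrow> bool" where
  "totally_positive M \<longleftrightarrow>
     (\<forall>I J. I \<subseteq> {..<dim_row M} \<and> J \<subseteq> {..<dim_col M} \<and> card I = card J \<longrightarrow>
        0 < det (submatrix M I J))"

(* A totally ordered set is a carrier X with a reflexive order relation r such that
   linear_order_on X r, so the strict order is r - Id.
   Quantifying over X and r over an arbitrary (at least two-element) type 'a covers all
   totally ordered sets, since 'a stays a type variable of the theorem. *)
definition increasing_tuple :: "'a set \<Rightarrow> 'a rel \<Rightarrow> nat \<Rightarrow> (nat \<Rightarrow> 'a) \<Rightarrow> bool" where
  "increasing_tuple X r n x \<longleftrightarrow>
     (\<forall>i < n. x i \<in> X) \<and> (\<forall>i j. i < j \<and> j < n \<longrightarrow> (x i, x j) \<in> r - Id)"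

(* Only the values of K on X \<times> Y matter. *)
definition totally_positive_kernel ::
  "'a set \<Rightarrow> 'a rel \<Rightarrow> 'b set \<Rightarrow> 'b rel \<Rightarrow> ('a \<Rightarrow> 'b \<Rightarrow> real) \<Rightarrow> bool" where
  "totally_positive_kernel X r Y s K \<longleftrightarrow>
     (\<forall>n x y. increasing_tuple X r n x \<and> increasing_tuple Y s n y \<longrightarrow>
        0 < det (mat n n (\<lambda>(i, j). K (x i) (y j))))"

end

theory Submission
  imports Defs
begin

text \<open>Taking logarithms, a totally positive \<open>2 \<times> 2\<close> matrix is \<open>c exp (w\<^sub>p \<alpha>\<^sub>q)\<close> with increasing
  \<open>w\<close> and \<open>\<alpha>\<close>, where positivity of the determinant is what makes \<open>w\<close> and \<open>\<alpha>\<close> solvable and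
  increasing. For matrices, \<open>w\<close> and \<open>\<alpha>\<close> extend affinely in the index. For kernels, a ratio of two
  rows (columns) of any given totally positive kernel embeds \<open>Y\<close> (\<open>X\<close>) into the reals, and after an
  affine change of variables one pulls back \<open>c exp (s t)\<close>. Total positivity of \<open>exp (s t)\<close> is by
  induction on the size: normalise the first column to ones, subtract adjacent rows, and apply the
  mean value theorem to each row, which leaves a smaller determinant of the same form.\<close>

section \<open>Determinants: scaling, row differences and a mean value theorem\<close>

lemma det_scale_rows:
  fixes f :: "nat \<Rightarrow> nat \<Rightarrow> 'a :: comm_ring_1"
  shows "det (mat n n (\<lambda>(i, j). c i * f i j)) = (\<Prod>i<n. c i) * det (mat n n (\<lambda>(i, j). f i j))"
  by (subst (1 2) det_def'[of _ n])
    (auto simp: prod.distrib lessThan_atLeast0 sum_distrib_left mult.left_commute intro!: sum.cong)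

lemma det_scale_cols:
  fixes f :: "nat \<Rightarrow> nat \<Rightarrow> 'a :: comm_ring_1"
  shows "det (mat n n (\<lambda>(i, j). c j * f i j)) = (\<Prod>i<n. c i) * det (mat n n (\<lambda>(i, j). f i j))"
proof -
  have "det (mat n n (\<lambda>(i, j). c j * f i j)) = det (mat n n (\<lambda>(i, j). c i * f j i))"
    by (subst det_transpose[of _ n, symmetric]) (auto intro!: arg_cong[of _ _ det])
  also have "\<dots> = (\<Prod>i<n. c i) * det (mat n n (\<lambda>(i, j). f j i))"
    by (rule det_scale_rows)
  also have "det (mat n n (\<lambda>(i, j). f j i)) = det (mat n n (\<lambda>(i, j). f i j))"
    by (subst det_transpose[of _ n, symmetric]) (auto intro!: arg_cong[of _ _ det])
  finally show ?thesis .
qed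

text \<open>Left multiplication by a unit lower bidiagonal matrix subtracts from each row its
  predecessor without changing the determinant. The column of ones becomes the first unit vector,
  and expansion along it leaves the row differences.\<close>

lemma det_first_col_ones:
  fixes f :: "nat \<Rightarrow> nat \<Rightarrow> 'a :: comm_ring_1"
  assumes "\<And>i. i \<le> n \<Longrightarrow> f i 0 = 1"
  shows "det (mat (Suc n) (Suc n) (\<lambda>(i, j). f i j)) =
    det (mat n n (\<lambda>(i, j). f (Suc i) (Suc j) - f i (Suc j)))"
proof -
  let ?M = "mat (Suc n) (Suc n) (\<lambda>(i, j). f i j)"
  define L :: "'a mat" where
    "L = mat (Suc n) (Suc n) (\<lambda>(i, j). if i = j then 1 else if i = Suc j then -1 else 0)"
  define D where
    "D = mat (Suc n) (Suc n) (\<lambda>(i, j). f i j - (if i = 0 then 0 else f (i - 1) j))"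
  have L: "L \<in> carrier_mat (Suc n) (Suc n)" and D: "D \<in> carrier_mat (Suc n) (Suc n)"
    by (simp_all add: L_def D_def)
  have "det L = prod_list (diag_mat L)"
    by (rule det_lower_triangular[OF _ L]) (auto simp: L_def)
  also have "diag_mat L = map (\<lambda>_. 1) [0..<Suc n]"
    by (auto simp: diag_mat_def L_def)
  also have "prod_list \<dots> = 1"
    by (induction n) auto
  finally have "det L = 1" .
  have "L * ?M = D"
  proof (rule eq_matI)
    fix i j assume "i < dim_row D" "j < dim_col D"
    then have ij: "i < Suc n" "j < Suc n" by (auto simp: D_def)
    have "(L * ?M) $$ (i, j) =
        (\<Sum>k = 0..<Suc n. (if i = k then 1 else if i = Suc k then -1 else 0) * f k j)"
      using ij by (simp add: L_def scalar_prod_def del: sum.op_ivl_Suc)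
    \<comment> \<open>Row \<open>i\<close> of \<open>L\<close> meets only \<open>k = i\<close> and
      \<open>k = i - 1\<close>. For \<open>i = 0\<close>, truncated subtraction would make
      \<open>k = 0\<close> count again, hence the inner \<open>if\<close>.\<close>
    also have "\<dots> = (\<Sum>k = 0..<Suc n. if k = i then f k j else 0) -
        (\<Sum>k = 0..<Suc n. if k = i - 1 then (if i = 0 then 0 else f k j) else 0)"
      unfolding sum_subtractf[symmetric] by (rule sum.cong) auto
    also have "\<dots> = D $$ (i, j)"
      using ij by (simp add: D_def sum.delta del: sum.op_ivl_Suc)
    finally show "(L * ?M) $$ (i, j) = D $$ (i, j)" .
  qed (auto simp: L_def D_def)
  with \<open>det L = 1\<close> det_mult[OF L, of ?M] have "det ?M = det D" by simp
  also have "\<dots> = (\<Sum>i<Suc n. D $$ (i, 0) * cofactor D i 0)"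
    by (rule laplace_expansion_column[OF D]) simp
  also have "\<dots> = (\<Sum>i<Suc n. if i = 0 then cofactor D 0 0 else 0)"
    by (rule sum.cong) (auto simp: D_def assms)
  also have "\<dots> = det (mat_delete D 0 0)"
    by (simp add: cofactor_def)
  also have "mat_delete D 0 0 = mat n n (\<lambda>(i, j). f (Suc i) (Suc j) - f i (Suc j))"
    by (auto simp: mat_delete_def D_def)
  finally show ?thesis .
qed

text \<open>The determinant is affine in each row, so the one-variable mean value theorem applies to the
  rows one after the other.\<close>

lemma det_mean_value:
  fixes \<phi> \<phi>' :: "nat \<Rightarrow> real \<Rightarrow> real"
  assumes ab: "\<And>i. i < n \<Longrightarrow> a i < b i"
    and deriv: "\<And>j t. j < n \<Longrightarrow> (\<phi> j has_real_derivative \<phi>' j t) (at t)"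
  obtains \<xi> where "\<And>i. i < n \<Longrightarrow> a i < \<xi> i \<and> \<xi> i < b i"
    "det (mat n n (\<lambda>(i, j). \<phi> j (b i) - \<phi> j (a i))) =
      (\<Prod>i<n. b i - a i) * det (mat n n (\<lambda>(i, j). \<phi>' j (\<xi> i)))"
proof -
  \<comment> \<open>\<open>?N k \<xi>\<close> is a hybrid whose first \<open>k\<close> rows are
    already derivatives at \<open>\<xi>\<close>; the induction converts one row of differences at a
    time.\<close>
  let ?N = "\<lambda>k \<xi>. mat n n (\<lambda>(i, j). if i < k then \<phi>' j (\<xi> i) else \<phi> j (b i) - \<phi> j (a i))"
  have "\<exists>\<xi>. (\<forall>i<k. a i < \<xi> i \<and> \<xi> i < b i) \<and>
      det (?N 0 \<xi>) = (\<Prod>i<k. b i - a i) * det (?N k \<xi>)" if "k \<le> n" for k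
    using that
  proof (induction k)
    case 0
    then show ?case by simp
  next
    case (Suc k)
    then obtain \<xi> where \<xi>: "\<forall>i<k. a i < \<xi> i \<and> \<xi> i < b i"
      "det (?N 0 \<xi>) = (\<Prod>i<k. b i - a i) * det (?N k \<xi>)" by auto
    \<comment> \<open>In \<open>R r\<close> row \<open>k\<close> is a free vector \<open>r\<close>.
      The cofactors along that row do not see it, so they may be computed with the row zero, and the
      determinant is linear in \<open>r\<close>.\<close>
    define R where "R r = mat n n (\<lambda>(i, j). if i = k then r j else
        if i < k then \<phi>' j (\<xi> i) else \<phi> j (b i) - \<phi> j (a i))" for r
    define C where "C j = cofactor (R (\<lambda>_. 0)) k j" for j
    have det_R: "det (R r) = (\<Sum>j<n. r j * C j)" for r
    proof -
      have "det (R r) = (\<Sum>j<n. R r $$ (k, j) * cofactor (R r) k j)"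
        by (rule laplace_expansion_row) (use Suc.prems in \<open>auto simp: R_def\<close>)
      also have "\<dots> = (\<Sum>j<n. r j * C j)"
      proof (rule sum.cong)
        fix j assume "j \<in> {..<n}"
        then have "R r $$ (k, j) = r j" using Suc.prems by (simp add: R_def)
        moreover have "mat_delete (R r) k j = mat_delete (R (\<lambda>_. 0)) k j"
          by (auto simp: mat_delete_def R_def)
        ultimately show "R r $$ (k, j) * cofactor (R r) k j = r j * C j"
          by (simp add: C_def cofactor_def)
      qed simp
      finally show ?thesis .
    qed
    \<comment> \<open>The mean value theorem is applied to the determinant as a function of
      \<open>t\<close>, with the values \<open>\<phi> j t\<close> in row \<open>k\<close>.\<close>
    have "\<exists>z. a k < z \<and> z < b k \<and> (\<Sum>j<n. \<phi> j (b k) * C j) - (\<Sum>j<n. \<phi> j (a k) * C j) =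
        (b k - a k) * (\<Sum>j<n. \<phi>' j z * C j)"
      using Suc.prems by (intro MVT2 ab) (auto intro!: DERIV_sum DERIV_cmult_right deriv)
    then obtain z where z: "a k < z" "z < b k"
      "(\<Sum>j<n. \<phi> j (b k) * C j) - (\<Sum>j<n. \<phi> j (a k) * C j) =
        (b k - a k) * (\<Sum>j<n. \<phi>' j z * C j)" by blast
    let ?\<xi> = "\<xi>(k := z)"
    have "?N k \<xi> = R (\<lambda>j. \<phi> j (b k) - \<phi> j (a k))"
      by (rule eq_matI) (auto simp: R_def)
    then have "det (?N k \<xi>) = (b k - a k) * (\<Sum>j<n. \<phi>' j z * C j)"
      using z(3) by (simp add: det_R left_diff_distrib sum_subtractf)
    also have "(\<Sum>j<n. \<phi>' j z * C j) = det (R (\<lambda>j. \<phi>' j z))"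
      by (simp add: det_R)
    also have "R (\<lambda>j. \<phi>' j z) = ?N (Suc k) ?\<xi>"
      by (rule eq_matI) (auto simp: R_def)
    finally have "det (?N 0 ?\<xi>) = (\<Prod>i<Suc k. b i - a i) * det (?N (Suc k) ?\<xi>)"
      using \<xi>(2) by simp
    moreover have "\<forall>i<Suc k. a i < ?\<xi> i \<and> ?\<xi> i < b i"
      using \<xi>(1) z by (auto simp: less_Suc_eq)
    ultimately show ?case by blast
  qed
  from this[of n] obtain \<xi> where \<xi>: "\<forall>i<n. a i < \<xi> i \<and> \<xi> i < b i"
    "det (?N 0 \<xi>) = (\<Prod>i<n. b i - a i) * det (?N n \<xi>)" by auto
  moreover have "?N 0 \<xi> = mat n n (\<lambda>(i, j). \<phi> j (b i) - \<phi> j (a i))"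
    and "?N n \<xi> = mat n n (\<lambda>(i, j). \<phi>' j (\<xi> i))" by auto
  ultimately show ?thesis using that by auto
qed

section \<open>Total positivity of the exponential kernel\<close>

lemma det_exp_pos:
  fixes w \<alpha> :: "nat \<Rightarrow> real"
  assumes "strict_mono_on {..<n} w" "strict_mono_on {..<n} \<alpha>"
  shows "0 < det (mat n n (\<lambda>(i, j). exp (w i * \<alpha> j)))"
  using assms
proof (induction n arbitrary: w \<alpha>)
  case 0
  then show ?case by simp
next
  case (Suc n)
  \<comment> \<open>The shift gives \<open>\<beta> 0 = 0\<close>, so the first column consists of
    ones once \<open>exp (w i * \<alpha> 0)\<close> is taken out of row \<open>i\<close>.\<close>
  define \<beta> where "\<beta> j = \<alpha> j - \<alpha> 0" for j
  have w: "w i < w j" if "i < j" "j \<le> n" for i j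
    using strict_mono_onD[OF Suc.prems(1), of i j] that by simp
  have \<alpha>: "\<alpha> i < \<alpha> j" if "i < j" "j \<le> n" for i j
    using strict_mono_onD[OF Suc.prems(2), of i j] that by simp
  obtain \<xi> where \<xi>: "\<And>i. i < n \<Longrightarrow> w i < \<xi> i \<and> \<xi> i < w (Suc i)"
    and det_\<xi>: "det (mat n n (\<lambda>(i, j). exp (w (Suc i) * \<beta> (Suc j)) - exp (w i * \<beta> (Suc j)))) =
      (\<Prod>i<n. w (Suc i) - w i) * det (mat n n (\<lambda>(i, j). \<beta> (Suc j) * exp (\<xi> i * \<beta> (Suc j))))"
  proof (rule det_mean_value[where n = n and a = w and b = "\<lambda>i. w (Suc i)"
        and \<phi> = "\<lambda>j t. exp (t * \<beta> (Suc j))" and \<phi>' = "\<lambda>j t. \<beta> (Suc j) * exp (t * \<beta> (Suc j))"])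
    show "w i < w (Suc i)" if "i < n" for i using that by (simp add: w)
    show "((\<lambda>t. exp (t * \<beta> (Suc j))) has_real_derivative \<beta> (Suc j) * exp (t * \<beta> (Suc j))) (at t)"
      for j t by (auto intro!: derivative_eq_intros)
  qed auto
  \<comment> \<open>Points chosen from the consecutive disjoint intervals between \<open>w i\<close>
    and \<open>w (Suc i)\<close> are automatically increasing.\<close>
  have "strict_mono_on {..<n} \<xi>"
  proof (rule strict_mono_onI)
    fix i j assume ij: "i \<in> {..<n}" "j \<in> {..<n}" "i < j"
    then have "w (Suc i) \<le> w j" using w[of "Suc i" j] by (cases "Suc i = j") auto
    then show "\<xi> i < \<xi> j" using \<xi>[of i] \<xi>[of j] ij by simp
  qed
  moreover have "strict_mono_on {..<n} (\<lambda>j. \<beta> (Suc j))"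
    by (rule strict_mono_onI) (auto simp: \<beta>_def \<alpha>)
  ultimately have IH: "0 < det (mat n n (\<lambda>(i, j). exp (\<xi> i * \<beta> (Suc j))))"
    by (rule Suc.IH)
  have "det (mat (Suc n) (Suc n) (\<lambda>(i, j). exp (w i * \<alpha> j))) =
      det (mat (Suc n) (Suc n) (\<lambda>(i, j). exp (w i * \<alpha> 0) * exp (w i * \<beta> j)))"
    by (intro arg_cong[of _ _ det]) (auto simp: \<beta>_def algebra_simps simp flip: exp_add)
  also have "\<dots> = (\<Prod>i<Suc n. exp (w i * \<alpha> 0)) *
      det (mat (Suc n) (Suc n) (\<lambda>(i, j). exp (w i * \<beta> j)))"
    by (rule det_scale_rows)
  also have "det (mat (Suc n) (Suc n) (\<lambda>(i, j). exp (w i * \<beta> j))) =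
      det (mat n n (\<lambda>(i, j). exp (w (Suc i) * \<beta> (Suc j)) - exp (w i * \<beta> (Suc j))))"
    by (rule det_first_col_ones) (simp add: \<beta>_def)
  also have "\<dots> = (\<Prod>i<n. w (Suc i) - w i) *
      ((\<Prod>j<n. \<beta> (Suc j)) * det (mat n n (\<lambda>(i, j). exp (\<xi> i * \<beta> (Suc j)))))"
    unfolding det_\<xi> by (simp only: det_scale_cols)
  also have "(\<Prod>i<Suc n. exp (w i * \<alpha> 0)) * \<dots> > 0"
    by (intro mult_pos_pos prod_pos IH) (auto simp: \<beta>_def w \<alpha>)
  finally show ?case .
qed

lemma det_scaled_exp_pos:
  fixes w \<alpha> :: "nat \<Rightarrow> real"
  assumes "0 < c" "strict_mono_on {..<n} w" "strict_mono_on {..<n} \<alpha>"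
  shows "0 < det (mat n n (\<lambda>(i, j). c * exp (w i * \<alpha> j)))"
  using det_exp_pos[OF assms(2,3)] assms(1)
  by (simp add: det_scale_rows[of n "\<lambda>_. c"])

section \<open>Totally positive 2 x 2 matrices and their exponential form\<close>

lemma det_2x2:
  assumes "A \<in> carrier_mat 2 2"
  shows "det A = A $$ (0, 0) * A $$ (1, 1) - A $$ (0, 1) * A $$ (1, 0)"
proof -
  have "det A = (\<Sum>j<2. A $$ (0, j) * cofactor A 0 j)"
    by (rule laplace_expansion_row[OF assms]) simp
  moreover have "det (mat_delete A 0 j) = mat_delete A 0 j $$ (0, 0)" if "j < 2" for j
    by (rule det_single) (use assms in \<open>auto simp: mat_delete_def\<close>)
  ultimately show ?thesis
    using assms by (simp add: cofactor_def numeral_2_eq_2) (simp add: mat_delete_def)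
qed

text \<open>\<open>submatrix\<close> reads its entries through \<open>pick\<close>; this lemma and
  the next evaluate \<open>pick\<close> on the nonempty index sets that occur for size 2.\<close>

lemma pick_singleton: "pick {i} 0 = i"
  by (auto intro: Least_equality)

lemma pick_lessThan: "i < n \<Longrightarrow> pick {..<n} i = i"
proof -
  assume "i < n"
  then have "{a \<in> {..<n}. a < i} = {..<i}" by auto
  with pick_card_in_set[of i "{..<n}"] \<open>i < n\<close> show ?thesis by simp
qed

text \<open>Index sets inside \<open>{..<2}\<close> are empty, singletons or full: the empty minor
  is 1, and the others are the entries and the full determinant.\<close>

lemma totally_positive_2x2_iff:
  assumes A: "A \<in> carrier_mat 2 2"
  shows "totally_positive A \<longleftrightarrow> (\<forall>p < 2. \<forall>q < 2. 0 < A $$ (p, q)) \<and> 0 < det A"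
proof -
  have full: "submatrix A {..<2} {..<2} = A"
    using A by (intro eq_matI)
      (auto simp: dim_submatrix submatrix_index pick_lessThan pick_lessThan[unfolded lessThan_def])
  have single: "det (submatrix A {p} {q}) = A $$ (p, q)" if "p < 2" "q < 2" for p q
  proof -
    have "{i. i < dim_row A \<and> i \<in> {p}} = {p}" "{j. j < dim_col A \<and> j \<in> {q}} = {q}"
      using A that by auto
    then have *: "card {i. i < dim_row A \<and> i \<in> {p}} = 1" "card {j. j < dim_col A \<and> j \<in> {q}} = 1"
      by simp_all
    then have "det (submatrix A {p} {q}) = submatrix A {p} {q} $$ (0, 0)"
      by (intro det_single carrier_matI) (simp_all only: dim_submatrix)
    then show ?thesis
      using * by (subst (asm) submatrix_index) (simp_all only: pick_singleton zero_less_one)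
  qed
  show ?thesis
  proof
    assume tp: "totally_positive A"
    have minor: "0 < det (submatrix A I J)" if "I \<subseteq> {..<2}" "J \<subseteq> {..<2}" "card I = card J" for I J
      using tp A that unfolding totally_positive_def by auto
    show "(\<forall>p < 2. \<forall>q < 2. 0 < A $$ (p, q)) \<and> 0 < det A"
      using minor[of "{..<2}" "{..<2}"] minor[of "{_}" "{_}"] by (auto simp: full simp flip: single)
  next
    assume pos: "(\<forall>p < 2. \<forall>q < 2. 0 < A $$ (p, q)) \<and> 0 < det A"
    show "totally_positive A"
      unfolding totally_positive_def
    proof (intro allI impI, elim conjE)
      fix I J assume "I \<subseteq> {..<dim_row A}" "J \<subseteq> {..<dim_col A}" and card: "card I = card J"
      then have IJ: "I \<subseteq> {..<2}" "J \<subseteq> {..<2}" using A by auto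
      then have "card I \<le> 2" using card_mono[of "{..<2::nat}" I] by simp
      then consider "card I = 0" | "card I = 1" | "card I = 2" by linarith
      then show "0 < det (submatrix A I J)"
      proof cases
        case 1
        then have "I = {}" "J = {}"
          using card IJ finite_subset[of _ "{..<2::nat}"] by auto
        then have "submatrix A I J \<in> carrier_mat 0 0" by (auto simp: dim_submatrix)
        then show ?thesis by simp
      next
        case 2
        then obtain p q where "I = {p}" "J = {q}" using card by (metis card_1_singletonE)
        then show ?thesis using pos IJ by (simp add: single)
      next
        case 3
        then have "I = {..<2}" "J = {..<2}"
          using card card_subset_eq[OF _ IJ(1)] card_subset_eq[OF _ IJ(2)] by simp_all
        then show ?thesis using pos by (simp add: full)
      qed
    qed
  qed
qed

text \<open>The entries are visibly positive, and the determinant is the case \<open>n = 2\<close>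
  of \<open>det_scaled_exp_pos\<close>.\<close>

lemma totally_positive_if_scaled_exp:
  fixes w \<alpha> :: "nat \<Rightarrow> real"
  assumes "A \<in> carrier_mat 2 2" "0 < c" "w 0 < w 1" "\<alpha> 0 < \<alpha> 1"
    and entries: "\<And>p q. p < 2 \<Longrightarrow> q < 2 \<Longrightarrow> A $$ (p, q) = c * exp (w p * \<alpha> q)"
  shows "totally_positive A"
proof -
  have mono: "strict_mono_on {..<2} f" if "f 0 < f 1" for f :: "nat \<Rightarrow> real"
    using that by (auto intro!: strict_mono_onI simp: less_2_cases_iff)
  have "A = mat 2 2 (\<lambda>(p, q). c * exp (w p * \<alpha> q))"
    using assms(1) by (intro eq_matI) (auto simp: entries)
  then have "0 < det A"
    using det_scaled_exp_pos[OF \<open>0 < c\<close> mono mono] assms(3,4) by metis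
  then show ?thesis
    using assms(1,2) by (simp add: totally_positive_2x2_iff entries)
qed

text \<open>For \<open>L = (ln a\<^bsub>pq\<^esub>)\<close> the matrix \<open>L - g J\<close>, with \<open>J\<close> the all-ones matrix, has determinant
  \<open>det L - g \<delta>\<close>, which vanishes for \<open>g = det L / \<delta>\<close>. Then \<open>L - g J\<close> is a product \<open>w \<alpha>\<^sup>T\<close>,
  normalised here so that \<open>\<alpha> 1 - \<alpha> 0 = 1\<close>.\<close>

lemma totally_positive_2x2_scaled_exp:
  assumes A: "A \<in> carrier_mat 2 2" and tp: "totally_positive A"
  obtains c :: real and w \<alpha> :: "nat \<Rightarrow> real" where "0 < c" "w 0 < w 1" "\<alpha> 0 < \<alpha> 1"
    "\<And>p q. p < 2 \<Longrightarrow> q < 2 \<Longrightarrow> A $$ (p, q) = c * exp (w p * \<alpha> q)"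
proof -
  define l where "l p q = ln (A $$ (p, q))" for p q
  \<comment> \<open>The logarithm of the cross ratio of the entries; a positive determinant makes it
    positive.\<close>
  define \<delta> where "\<delta> = l 0 0 + l 1 1 - l 0 1 - l 1 0"
  define g where "g = (l 0 0 * l 1 1 - l 0 1 * l 1 0) / \<delta>"
  \<comment> \<open>Forced by the normalisation: column differences of
    \<open>w p * \<alpha> q\<close> equal \<open>w p\<close>, and row differences equal
    \<open>\<delta> * \<alpha> q\<close>, since \<open>w 1 - w 0 = \<delta>\<close>.\<close>
  define w where "w p = l p 1 - l p 0" for p
  define \<alpha> where "\<alpha> q = (l 1 q - l 0 q) / \<delta>" for q
  have pos: "0 < A $$ (p, q)" if "p < 2" "q < 2" for p q
    using tp that by (simp add: totally_positive_2x2_iff[OF A])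
  have "A $$ (0, 1) * A $$ (1, 0) < A $$ (0, 0) * A $$ (1, 1)"
    using tp by (simp add: totally_positive_2x2_iff[OF A] det_2x2[OF A])
  then have "ln (A $$ (0, 1) * A $$ (1, 0)) < ln (A $$ (0, 0) * A $$ (1, 1))"
    using pos by (subst ln_less_cancel_iff) auto
  then have \<delta>: "0 < \<delta>"
    using pos[of 0 0] pos[of 0 1] pos[of 1 0] pos[of 1 1] by (simp add: \<delta>_def l_def ln_mult)
  have l: "l p q = g + w p * \<alpha> q" if "p < 2" "q < 2" for p q
  proof -
    \<comment> \<open>Cleared of the denominator, each of the four cases is a polynomial identity in
      the logarithms.\<close>
    have "\<delta> * (g + w p * \<alpha> q) = (l 0 0 * l 1 1 - l 0 1 * l 1 0) + w p * (l 1 q - l 0 q)"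
      using \<delta> by (simp add: g_def \<alpha>_def field_simps)
    also have "\<dots> = \<delta> * l p q"
      using that by (auto simp: less_2_cases_iff \<delta>_def w_def algebra_simps)
    finally show ?thesis using \<delta> by simp
  qed
  have "A $$ (p, q) = exp g * exp (w p * \<alpha> q)" if "p < 2" "q < 2" for p q
    unfolding exp_add[symmetric] l[OF that, symmetric] l_def using pos[OF that] by simp
  moreover have "w 0 < w 1" using \<delta> by (simp add: w_def \<delta>_def)
  moreover have "\<alpha> 1 - \<alpha> 0 = 1"
    using \<delta> by (simp add: \<alpha>_def \<delta>_def flip: diff_divide_distrib)
  ultimately show ?thesis by (intro that[of "exp g" w \<alpha>]) auto
qed

section \<open>Affine rescaling and totally positive kernels on ordered sets\<close>

lemma affine_interpolation:
  fixes a b u v :: real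
  assumes "a < b" "u < v"
  obtains k d where "0 < k" "k * a + d = u" "k * b + d = v"
proof
  show "0 < (v - u) / (b - a)" using assms by simp
  show "(v - u) / (b - a) * a + (u - (v - u) / (b - a) * a) = u" by simp
  have "(v - u) / (b - a) * b - (v - u) / (b - a) * a = (v - u) / (b - a) * (b - a)"
    by (rule right_diff_distrib[symmetric])
  also have "\<dots> = v - u" using assms by simp
  finally have "(v - u) / (b - a) * b - (v - u) / (b - a) * a = v - u" .
  then show "(v - u) / (b - a) * b + (u - (v - u) / (b - a) * a) = v" by linarith
qed

lemma increasing_tuple_2_iff:
  "increasing_tuple X r 2 x \<longleftrightarrow> x 0 \<in> X \<and> x 1 \<in> X \<and> (x 0, x 1) \<in> r - Id"
  unfolding increasing_tuple_def by (auto simp: less_2_cases_iff)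

text \<open>Strictly increasing maps turn increasing tuples into increasing real tuples, so every
  determinant to be tested is one of the exponential kernel.\<close>

lemma totally_positive_kernel_scaled_exp:
  fixes f :: "'a \<Rightarrow> real" and g :: "'b \<Rightarrow> real"
  assumes "0 < c"
    and f: "\<And>a b. a \<in> X \<Longrightarrow> b \<in> X \<Longrightarrow> (a, b) \<in> r - Id \<Longrightarrow> f a < f b"
    and g: "\<And>a b. a \<in> Y \<Longrightarrow> b \<in> Y \<Longrightarrow> (a, b) \<in> s - Id \<Longrightarrow> g a < g b"
  shows "totally_positive_kernel X r Y s (\<lambda>x y. c * exp (f x * g y))"
  unfolding totally_positive_kernel_def
proof (intro allI impI, elim conjE)
  fix n x y
  assume "increasing_tuple X r n x" "increasing_tuple Y s n y"
  then have "strict_mono_on {..<n} (\<lambda>i. f (x i))" "strict_mono_on {..<n} (\<lambda>i. g (y i))"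
    unfolding increasing_tuple_def by (auto intro!: strict_mono_onI f g)
  with \<open>0 < c\<close> show "0 < det (mat n n (\<lambda>(i, j). c * exp (f (x i) * g (y j))))"
    by (rule det_scaled_exp_pos)
qed

lemma totally_positive_kernel_entry_pos:
  assumes "totally_positive_kernel X r Y s K" "a \<in> X" "b \<in> Y"
  shows "0 < K a b"
proof -
  have "increasing_tuple X r 1 (\<lambda>_. a)" "increasing_tuple Y s 1 (\<lambda>_. b)"
    using assms by (auto simp: increasing_tuple_def)
  with assms(1) have "0 < det (mat 1 1 (\<lambda>(i, j). K a b))"
    unfolding totally_positive_kernel_def by fastforce
  then show ?thesis by (subst (asm) det_single) auto
qed

lemma totally_positive_kernel_minor2_pos:
  assumes "totally_positive_kernel X r Y s K" "increasing_tuple X r 2 x" "increasing_tuple Y s 2 y"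
  shows "K (x 0) (y 1) * K (x 1) (y 0) < K (x 0) (y 0) * K (x 1) (y 1)"
proof -
  have "0 < det (mat 2 2 (\<lambda>(i, j). K (x i) (y j)))"
    using assms unfolding totally_positive_kernel_def by blast
  then show ?thesis by (subst (asm) det_2x2) auto
qed

text \<open>Exchanges the two orders, so that the embedding of \<open>Y\<close> constructed next
  also yields one of \<open>X\<close>.\<close>

lemma totally_positive_kernel_transpose:
  assumes "totally_positive_kernel X r Y s K"
  shows "totally_positive_kernel Y s X r (\<lambda>y x. K x y)"
  unfolding totally_positive_kernel_def
proof (intro allI impI, elim conjE)
  fix n y x
  assume "increasing_tuple Y s n y" "increasing_tuple X r n x"
  with assms have "0 < det (mat n n (\<lambda>(i, j). K (x i) (y j)))"
    unfolding totally_positive_kernel_def by blast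
  also have "\<dots> = det (mat n n (\<lambda>(i, j). K (x j) (y i)))"
    by (subst det_transpose[of _ n, symmetric]) (auto intro!: arg_cong[of _ _ det])
  finally show "0 < det (mat n n (\<lambda>(i, j). K (x j) (y i)))" .
qed

text \<open>The quotient of two rows of the kernel is strictly increasing.\<close>

lemma totally_positive_kernel_embedding:
  fixes u v :: real
  assumes K: "totally_positive_kernel X r Y s K"
    and x: "increasing_tuple X r 2 x" and y: "increasing_tuple Y s 2 y" and "u < v"
  obtains g :: "'b \<Rightarrow> real" where "g (y 0) = u" "g (y 1) = v"
    "\<And>a b. a \<in> Y \<Longrightarrow> b \<in> Y \<Longrightarrow> (a, b) \<in> s - Id \<Longrightarrow> g a < g b"
proof -
  define q where "q b = K (x 1) b / K (x 0) b" for b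
  have q: "q a < q b" if ab: "a \<in> Y" "b \<in> Y" "(a, b) \<in> s - Id" for a b
  proof -
    have "increasing_tuple Y s 2 (\<lambda>i. if i = 0 then a else b)"
      using ab by (simp add: increasing_tuple_2_iff)
    \<comment> \<open>Divided by the positive product \<open>K (x 0) a * K (x 0) b\<close>, this
      minor is exactly \<open>q b - q a\<close>.\<close>
    from totally_positive_kernel_minor2_pos[OF K x this]
    have "K (x 0) b * K (x 1) a < K (x 0) a * K (x 1) b" by simp
    moreover have "0 < K (x 0) a" "0 < K (x 0) b"
      using totally_positive_kernel_entry_pos[OF K] x ab by (auto simp: increasing_tuple_2_iff)
    ultimately show ?thesis by (simp add: q_def field_simps)
  qed
  have "q (y 0) < q (y 1)" using y by (simp add: increasing_tuple_2_iff q)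
  then obtain k d where "0 < k" "k * q (y 0) + d = u" "k * q (y 1) + d = v"
    using affine_interpolation \<open>u < v\<close> by blast
  then show ?thesis by (intro that[of "\<lambda>b. k * q b + d"]) (auto simp: q)
qed

text \<open>Supplies the two-point chains on which the kernel condition is tested to recover total
  positivity of the matrix.\<close>

lemma linear_order_pair:
  assumes "a \<noteq> b"
  shows "linear_order_on {a, b} {(a, a), (b, b), (a, b)}"
  using assms
  by (auto simp: linear_order_on_def partial_order_on_def preorder_on_def refl_on_def
      total_on_def intro!: transI antisymI)

section \<open>Completions and their converses\<close>

lemma totally_positive_imp_vandermonde_completion:
  fixes i j :: "nat \<Rightarrow> nat"
  assumes A: "A \<in> carrier_mat 2 2" and tp: "totally_positive A"
    and ij: "i 0 < i 1" "i 1 < m" "j 0 < j 1" "j 1 < n"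
  shows "\<exists>V c. V \<in> carrier_mat m n \<and> gen_vandermonde V \<and> 0 < c \<and>
    (\<forall>p < 2. \<forall>q < 2. (c \<cdot>\<^sub>m V) $$ (i p, j q) = A $$ (p, q))"
proof -
  obtain c w \<alpha> where "0 < c" and w: "w 0 < w 1" and \<alpha>: "\<alpha> 0 < \<alpha> 1"
    and entries: "\<And>p q. p < 2 \<Longrightarrow> q < 2 \<Longrightarrow> A $$ (p, q) = c * exp (w p * \<alpha> q)"
    using totally_positive_2x2_scaled_exp[OF A tp] by metis
  \<comment> \<open>An increasing affine function through the two prescribed values keeps the order
    at all remaining indices.\<close>
  obtain k d where k: "0 < k" "k * real (i 0) + d = w 0" "k * real (i 1) + d = w 1"
    using affine_interpolation[OF _ w] ij by (metis of_nat_less_iff)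
  obtain k' d' where k': "0 < k'" "k' * real (j 0) + d' = \<alpha> 0" "k' * real (j 1) + d' = \<alpha> 1"
    using affine_interpolation[OF _ \<alpha>] ij by (metis of_nat_less_iff)
  \<comment> \<open>Exponential nodes turn \<open>u s powr \<beta> t\<close> into \<open>exp\<close>
    of a product of affine functions, which is \<open>exp (w p * \<alpha> q)\<close> at the
    prescribed positions; \<open>c\<close> becomes the scalar multiple.\<close>
  define u where "u t = exp (k * real t + d)" for t
  define \<beta> where "\<beta> t = k' * real t + d'" for t
  define V where "V = mat m n (\<lambda>(s, t). u s powr \<beta> t)"
  have "strict_mono_on {..<m} u" "strict_mono_on {..<n} \<beta>"
    using k k' by (auto intro!: strict_mono_onI simp: u_def \<beta>_def)
  then have "gen_vandermonde V"
    unfolding gen_vandermonde_def V_def by (intro exI[of _ u] exI[of _ \<beta>]) (auto simp: u_def)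
  moreover have "V \<in> carrier_mat m n" by (simp add: V_def)
  moreover have "(c \<cdot>\<^sub>m V) $$ (i p, j q) = A $$ (p, q)" if "p < 2" "q < 2" for p q
  proof -
    have "i p < m" "j q < n" using that ij by (auto simp: less_2_cases_iff)
    moreover have "u (i p) = exp (w p)" "\<beta> (j q) = \<alpha> q"
      using that k k' by (auto simp: less_2_cases_iff u_def \<beta>_def)
    ultimately show ?thesis
      using that by (simp add: V_def entries powr_def mult.commute)
  qed
  ultimately show ?thesis using \<open>0 < c\<close> by blast
qed

text \<open>A positive power is \<open>exp (ln (u p) * \<alpha> q)\<close>, so the multiple has the
  scaled exponential form.\<close>

lemma vandermonde_multiple_imp_totally_positive:
  assumes A: "A \<in> carrier_mat 2 2" and V: "V \<in> carrier_mat 2 2" "gen_vandermonde V" and "0 < c"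
    and entries: "\<And>p q. p < 2 \<Longrightarrow> q < 2 \<Longrightarrow> (c \<cdot>\<^sub>m V) $$ (p, q) = A $$ (p, q)"
  shows "totally_positive A"
proof -
  have dim: "dim_row V = 2" "dim_col V = 2" using V(1) by auto
  obtain u \<alpha> where u: "\<forall>i<2. 0 < u i"
    and mono: "strict_mono_on {..<2} u \<and> strict_mono_on {..<2} \<alpha> \<or>
      strict_antimono_on {..<2} u \<and> strict_antimono_on {..<2} \<alpha>"
    and V_eq: "V = mat 2 2 (\<lambda>(i, j). u i powr \<alpha> j)"
    using V(2)[unfolded gen_vandermonde_def dim] by blast
  have A_eq: "A $$ (p, q) = c * exp (ln (u p) * \<alpha> q)" if "p < 2" "q < 2" for p q
    using u that entries[OF that] by (simp add: V_eq powr_def mult.commute less_imp_neq[symmetric])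
  from mono consider "u 0 < u 1" "\<alpha> 0 < \<alpha> 1" | "u 1 < u 0" "\<alpha> 1 < \<alpha> 0"
    by (auto simp: monotone_on_def)
  then show ?thesis
  proof cases
    case 1
    then show ?thesis
      using u by (intro totally_positive_if_scaled_exp[OF A \<open>0 < c\<close>, of "\<lambda>p. ln (u p)" \<alpha>]) (auto simp: A_eq)
  next
    \<comment> \<open>Negating both \<open>ln (u p)\<close> and \<open>\<alpha> q\<close> keeps
      their product and turns decreasing sequences into increasing ones.\<close>
    case 2
    then show ?thesis
      using u by (intro totally_positive_if_scaled_exp[OF A \<open>0 < c\<close>, of "\<lambda>p. - ln (u p)" "\<lambda>q. - \<alpha> q"])
        (auto simp: A_eq)
  qed
qed

text \<open>The given kernel enters through the order embeddings that its quotients provide; the new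
  kernel is the exponential one pulled back along them.\<close>

lemma totally_positive_imp_kernel_completion:
  assumes A: "A \<in> carrier_mat 2 2" and tp: "totally_positive A"
    and K: "totally_positive_kernel X r Y s K"
    and x: "increasing_tuple X r 2 x" and y: "increasing_tuple Y s 2 y"
  shows "\<exists>K. totally_positive_kernel X r Y s K \<and> (\<forall>p < 2. \<forall>q < 2. K (x p) (y q) = A $$ (p, q))"
proof -
  obtain c w \<alpha> where "0 < c" and w: "w 0 < w 1" and \<alpha>: "\<alpha> 0 < \<alpha> 1"
    and entries: "\<And>p q. p < 2 \<Longrightarrow> q < 2 \<Longrightarrow> A $$ (p, q) = c * exp (w p * \<alpha> q)"
    using totally_positive_2x2_scaled_exp[OF A tp] by metis
  obtain f where f: "f (x 0) = w 0" "f (x 1) = w 1"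
      "\<And>a b. a \<in> X \<Longrightarrow> b \<in> X \<Longrightarrow> (a, b) \<in> r - Id \<Longrightarrow> f a < f b"
    using totally_positive_kernel_embedding[OF totally_positive_kernel_transpose[OF K] y x w]
    by metis
  obtain g where g: "g (y 0) = \<alpha> 0" "g (y 1) = \<alpha> 1"
      "\<And>a b. a \<in> Y \<Longrightarrow> b \<in> Y \<Longrightarrow> (a, b) \<in> s - Id \<Longrightarrow> g a < g b"
    using totally_positive_kernel_embedding[OF K x y \<alpha>] by metis
  have "totally_positive_kernel X r Y s (\<lambda>a b. c * exp (f a * g b))"
    using \<open>0 < c\<close> f(3) g(3) by (rule totally_positive_kernel_scaled_exp)
  moreover have "\<forall>p < 2. \<forall>q < 2. c * exp (f (x p) * g (y q)) = A $$ (p, q)"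
    using f g by (auto simp: entries less_2_cases_iff)
  ultimately show ?thesis by blast
qed

lemma kernel_imp_totally_positive:
  assumes A: "A \<in> carrier_mat 2 2" and K: "totally_positive_kernel X r Y s K"
    and x: "increasing_tuple X r 2 x" and y: "increasing_tuple Y s 2 y"
    and entries: "\<And>p q. p < 2 \<Longrightarrow> q < 2 \<Longrightarrow> K (x p) (y q) = A $$ (p, q)"
  shows "totally_positive A"
proof -
  have "0 < A $$ (p, q)" if "p < 2" "q < 2" for p q
    using totally_positive_kernel_entry_pos[OF K, of "x p" "y q"] x y that
    by (auto simp: increasing_tuple_def entries)
  moreover have "0 < det A"
    using totally_positive_kernel_minor2_pos[OF K x y] by (simp add: det_2x2[OF A] entries)
  ultimately show ?thesis by (simp add: totally_positive_2x2_iff[OF A])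
qed

text \<open>Over a one-element type no increasing pair exists and the kernel condition would hold
  for every \<open>A\<close>; hence the two distinct elements on each side. Pairs are encoded as
  functions on \<open>nat\<close> read at 0 and 1.\<close>

theorem theorem4p6:
  fixes A :: "real mat"
  assumes "A \<in> carrier_mat 2 2"
    and "\<exists>a b :: 'x. a \<noteq> b"
    and "\<exists>a b :: 'y. a \<noteq> b"
  shows
    "((\<forall>m \<ge> 2. \<forall>n \<ge> 2. \<forall>i j :: nat \<Rightarrow> nat.
         i 0 < i 1 \<and> i 1 < m \<and> j 0 < j 1 \<and> j 1 < n \<longrightarrow>
         (\<exists>B V :: real mat. \<exists>c :: real.
            V \<in> carrier_mat m n \<and> gen_vandermonde V \<and> 0 < c \<and> B = c \<cdot>\<^sub>m V \<and>
            (\<forall>p < 2. \<forall>q < 2. B $$ (i p, j q) = A $$ (p, q))))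
      \<longleftrightarrow> totally_positive A) \<and>
     ((\<forall>(X :: 'x set) r (Y :: 'y set) s.
         linear_order_on X r \<and> linear_order_on Y s \<and>
         (\<exists>K. totally_positive_kernel X r Y s K) \<longrightarrow>
         (\<forall>(x :: nat \<Rightarrow> 'x) (y :: nat \<Rightarrow> 'y).
            increasing_tuple X r 2 x \<and> increasing_tuple Y s 2 y \<longrightarrow>
            (\<exists>K. totally_positive_kernel X r Y s K \<and>
               (\<forall>p < 2. \<forall>q < 2. K (x p) (y q) = A $$ (p, q)))))
      \<longleftrightarrow> totally_positive A)"
proof (intro conjI iffI allI impI; (elim conjE)?)
  assume *: "\<forall>m \<ge> 2. \<forall>n \<ge> 2. \<forall>i j :: nat \<Rightarrow> nat.
      i 0 < i 1 \<and> i 1 < m \<and> j 0 < j 1 \<and> j 1 < n \<longrightarrow>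
      (\<exists>B V :: real mat. \<exists>c :: real.
        V \<in> carrier_mat m n \<and> gen_vandermonde V \<and> 0 < c \<and> B = c \<cdot>\<^sub>m V \<and>
        (\<forall>p < 2. \<forall>q < 2. B $$ (i p, j q) = A $$ (p, q)))"
  \<comment> \<open>For \<open>m = n = 2\<close> the prescribed positions fill the whole
    matrix.\<close>
  from *[rule_format, of 2 2 "\<lambda>p. p" "\<lambda>q. q"] show "totally_positive A"
    using vandermonde_multiple_imp_totally_positive[OF assms(1)] by auto
next
  fix m n :: nat and i j :: "nat \<Rightarrow> nat"
  assume "totally_positive A" "i 0 < i 1" "i 1 < m" "j 0 < j 1" "j 1 < n"
  then show "\<exists>B V :: real mat. \<exists>c :: real.
      V \<in> carrier_mat m n \<and> gen_vandermonde V \<and> 0 < c \<and> B = c \<cdot>\<^sub>m V \<and>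
      (\<forall>p < 2. \<forall>q < 2. B $$ (i p, j q) = A $$ (p, q))"
    using totally_positive_imp_vandermonde_completion[OF assms(1)] by blast
next
  assume *: "\<forall>(X :: 'x set) r (Y :: 'y set) s.
      linear_order_on X r \<and> linear_order_on Y s \<and>
      (\<exists>K. totally_positive_kernel X r Y s K) \<longrightarrow>
      (\<forall>(x :: nat \<Rightarrow> 'x) (y :: nat \<Rightarrow> 'y).
        increasing_tuple X r 2 x \<and> increasing_tuple Y s 2 y \<longrightarrow>
        (\<exists>K. totally_positive_kernel X r Y s K \<and>
          (\<forall>p < 2. \<forall>q < 2. K (x p) (y q) = A $$ (p, q))))"
  obtain a b :: 'x where ab: "a \<noteq> b" using assms(2) by blast
  obtain a' b' :: 'y where ab': "a' \<noteq> b'" using assms(3) by blast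
  define r where "r = {(a, a), (b, b), (a, b)}"
  define s where "s = {(a', a'), (b', b'), (a', b')}"
  define x where "x p = (if p = 0 then a else b)" for p :: nat
  define y where "y q = (if q = 0 then a' else b')" for q :: nat
  have orders: "linear_order_on {a, b} r" "linear_order_on {a', b'} s"
    unfolding r_def s_def using ab ab' by (simp_all add: linear_order_pair)
  have xy: "increasing_tuple {a, b} r 2 x" "increasing_tuple {a', b'} s 2 y"
    using ab ab' by (simp_all add: increasing_tuple_2_iff x_def y_def r_def s_def)
  \<comment> \<open>The condition applies only if the two chains admit some totally positive kernel.
    The indicators of \<open>b\<close> and \<open>b'\<close> embed them as 0 < 1, and the factor
    \<open>1\<close> fits the scaled form.\<close>
  have "totally_positive_kernel {a, b} r {a', b'} s
      (\<lambda>x y. 1 * exp (of_bool (x = b) * of_bool (y = b')))"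
    using ab ab' by (intro totally_positive_kernel_scaled_exp) (auto simp: r_def s_def)
  with * orders xy obtain K where "totally_positive_kernel {a, b} r {a', b'} s K"
    "\<forall>p < 2. \<forall>q < 2. K (x p) (y q) = A $$ (p, q)" by blast
  then show "totally_positive A"
    using kernel_imp_totally_positive[OF assms(1) _ xy] by blast
next
  fix X :: "'x set" and r and Y :: "'y set" and s and x :: "nat \<Rightarrow> 'x" and y :: "nat \<Rightarrow> 'y"
  assume "totally_positive A" "\<exists>K. totally_positive_kernel X r Y s K"
    "increasing_tuple X r 2 x" "increasing_tuple Y s 2 y"
  then show "\<exists>K. totally_positive_kernel X r Y s K \<and>
      (\<forall>p < 2. \<forall>q < 2. K (x p) (y q) = A $$ (p, q))"
    using totally_positive_imp_kernel_completion[OF assms(1)] by blast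
qed

end
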